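(* Let $a^0\in\ell_2(\mathbb Z,\mathbb C)$ with $a^0\ne0$, and let $a\in C^1(\mathbb R,\ell_2(\mathbb Z,\mathbb C))$ denote the solution of the discrete $p$-Schrödinger equation $$i\,\frac{\partial a_n}{\partial\tau}=\omega_0\,(\Delta_{\alpha+1}a)_n,\quad n\in\mathbb Z,$$ with $a(0)=a^0$. Then $$\forall\tau\in\mathbb R,\qquad\|a(\tau)\|_\infty\ge\left(\frac{\|\frac12\delta^+a^0\|_{\alpha+1}^{\alpha+1}}{\|a^0\|_2^2}\right)^{\frac1{\alpha-1}}.$$
   Context: Here $\alpha>1$; $\omega_0\in\mathbb R$ is the constant $\omega_0=(k_-+k_+)\,2^{\frac{\alpha-3}{2}}\,\frac{\alpha\,\Gamma(\alpha/2)}{\sqrt\pi\,(\alpha+1)\,\Gamma((\alpha+1)/2)}$ with real $(k_-,k_+)\ne(0,0)$; $(\delta^+a)_n=a_{n+1}-a_n$; and $(\Delta_{\alpha+1}a)_n=(a_{n+1}-a_n)|a_{n+1}-a_n|^{\alpha-1}-(a_n-a_{n-1})|a_n-a_{n-1}|^{\alpha-1}$. The norms are the usual $\ell_q(\mathbb Z,\mathbb C)$ norms. The Cauchy problem in $\ell_2(\mathbb Z,\mathbb C)$ is globally well-posed. *)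

theory Defs
  imports "HOL-Analysis.Analysis"
begin

definition ell :: "real \<Rightarrow> (int \<Rightarrow> complex) set" where
  "ell q = {x. (\<lambda>n. norm (x n) powr q) summable_on UNIV}"

text \<open>Outside \<open>ell q\<close> the value is 0, not \<open>\<infinity>\<close>.\<close>

definition ell_norm :: "real \<Rightarrow> (int \<Rightarrow> complex) \<Rightarrow> real" where
  "ell_norm q x = (\<Sum>\<^sub>\<infinity>n. norm (x n) powr q) powr (1 / q)"

text \<open>Unspecified for unbounded sequences.\<close>

definition ell_infnorm :: "(int \<Rightarrow> complex) \<Rightarrow> real" where
  "ell_infnorm x = (SUP n. norm (x n))"

lemma ell_2_iff: "x \<in> ell 2 \<longleftrightarrow> (\<lambda>n. (norm (x n))\<^sup>2) summable_on UNIV"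
  by (simp add: ell_def)

lemma ell_norm_2: "ell_norm 2 x = sqrt (\<Sum>\<^sub>\<infinity>n. (norm (x n))\<^sup>2)"
  by (simp add: ell_norm_def powr_half_sqrt infsum_nonneg)

lemma ell_2_L2_set_le:
  assumes "x \<in> ell 2" "finite F"
  shows "L2_set (\<lambda>n. norm (x n)) F \<le> ell_norm 2 x"
  unfolding L2_set_def ell_norm_2
  using assms by (intro real_sqrt_le_mono finite_sum_le_infsum) (auto simp: ell_2_iff)

lemma ell_2_bound:
  assumes "\<And>F. finite F \<Longrightarrow> L2_set (\<lambda>n. norm (x n)) F \<le> c"
  shows "x \<in> ell 2" "ell_norm 2 x \<le> c"
proof -
  have c: "0 \<le> c" using assms[of "{}"] by simp
  have le: "(\<Sum>n\<in>F. (norm (x n))\<^sup>2) \<le> c\<^sup>2" if "finite F" for F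
    using assms[OF that] c unfolding L2_set_def by (simp add: sqrt_le_D)
  show x: "x \<in> ell 2"
    unfolding ell_2_iff
    by (rule nonneg_bounded_partial_sums_imp_summable_on[where C = "c\<^sup>2"])
       (auto intro!: le eventually_finite_subsets_at_top_weakI)
  have "(\<Sum>\<^sub>\<infinity>n. (norm (x n))\<^sup>2) \<le> c\<^sup>2"
    using x le by (intro infsum_le_finite_sums) (auto simp: ell_2_iff)
  with c show "ell_norm 2 x \<le> c"
    unfolding ell_norm_2 by (simp add: real_le_lsqrt infsum_nonneg)
qed

lemma ell_2_add:
  assumes "x \<in> ell 2" "y \<in> ell 2"
  shows "(\<lambda>n. x n + y n) \<in> ell 2"
    and "ell_norm 2 (\<lambda>n. x n + y n) \<le> ell_norm 2 x + ell_norm 2 y"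
proof -
  have "L2_set (\<lambda>n. norm (x n + y n)) F \<le> ell_norm 2 x + ell_norm 2 y" if F: "finite F" for F
  proof -
    have "L2_set (\<lambda>n. norm (x n + y n)) F \<le> L2_set (\<lambda>n. norm (x n) + norm (y n)) F"
      by (intro L2_set_mono norm_triangle_ineq) auto
    also have "\<dots> \<le> L2_set (\<lambda>n. norm (x n)) F + L2_set (\<lambda>n. norm (y n)) F"
      by (rule L2_set_triangle_ineq)
    also have "\<dots> \<le> ell_norm 2 x + ell_norm 2 y"
      by (intro add_mono ell_2_L2_set_le assms F)
    finally show ?thesis .
  qed
  then show "(\<lambda>n. x n + y n) \<in> ell 2"
    "ell_norm 2 (\<lambda>n. x n + y n) \<le> ell_norm 2 x + ell_norm 2 y"
    using ell_2_bound[of "\<lambda>n. x n + y n" "ell_norm 2 x + ell_norm 2 y"] by blast+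
qed

lemma ell_2_scaleR:
  assumes "x \<in> ell 2"
  shows "(\<lambda>n. r *\<^sub>R x n) \<in> ell 2"
  using summable_on_cmult_right[OF assms[unfolded ell_2_iff], of "r\<^sup>2"]
  by (simp add: ell_2_iff power_mult_distrib)

lemma ell_norm_2_scaleR: "ell_norm 2 (\<lambda>n. r *\<^sub>R x n) = \<bar>r\<bar> * ell_norm 2 x"
  by (simp add: ell_norm_2 power_mult_distrib infsum_cmult_right' real_sqrt_mult)

lemma ell_2_uminus: "x \<in> ell 2 \<Longrightarrow> (\<lambda>n. - x n) \<in> ell 2"
  by (simp add: ell_2_iff)

lemma ell_2_diff: "x \<in> ell 2 \<Longrightarrow> y \<in> ell 2 \<Longrightarrow> (\<lambda>n. x n - y n) \<in> ell 2"
  using ell_2_add(1)[of x "\<lambda>n. - y n"] ell_2_uminus[of y] by simp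

typedef ell2 = "ell 2"
  morphisms ell2_nth Ell2
  by (rule exI[of _ "\<lambda>_. 0"]) (simp add: ell_2_iff)

setup_lifting type_definition_ell2

instantiation ell2 :: real_normed_vector
begin

lift_definition zero_ell2 :: ell2 is "\<lambda>_. 0" by (simp add: ell_2_iff)
lift_definition plus_ell2 :: "ell2 \<Rightarrow> ell2 \<Rightarrow> ell2" is "\<lambda>x y n. x n + y n"
  by (rule ell_2_add)
lift_definition minus_ell2 :: "ell2 \<Rightarrow> ell2 \<Rightarrow> ell2" is "\<lambda>x y n. x n - y n"
  by (rule ell_2_diff)
lift_definition uminus_ell2 :: "ell2 \<Rightarrow> ell2" is "\<lambda>x n. - x n"
  by (rule ell_2_uminus)
lift_definition scaleR_ell2 :: "real \<Rightarrow> ell2 \<Rightarrow> ell2" is "\<lambda>r x n. r *\<^sub>R x n"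
  by (rule ell_2_scaleR)
lift_definition norm_ell2 :: "ell2 \<Rightarrow> real" is "ell_norm 2" .

definition dist_ell2 :: "ell2 \<Rightarrow> ell2 \<Rightarrow> real" where
  "dist_ell2 x y = norm (x - y)"
definition sgn_ell2 :: "ell2 \<Rightarrow> ell2" where
  "sgn_ell2 x = scaleR (inverse (norm x)) x"
definition uniformity_ell2 :: "(ell2 \<times> ell2) filter" where
  "uniformity_ell2 = (INF e\<in>{0<..}. principal {(x, y). dist x y < e})"
definition open_ell2 :: "ell2 set \<Rightarrow> bool" where
  "open_ell2 U \<longleftrightarrow> (\<forall>x\<in>U. \<forall>\<^sub>F (x', y) in uniformity. x' = x \<longrightarrow> y \<in> U)"

instance
proof
  fix x y z :: ell2 and r s :: real
  show "x + y + z = x + (y + z)" by transfer (simp add: add.assoc)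
  show "x + y = y + x" by transfer (simp add: add.commute)
  show "0 + x = x" by transfer simp
  show "- x + x = 0" by transfer simp
  show "x - y = x + - y" by transfer simp
  show "r *\<^sub>R (x + y) = r *\<^sub>R x + r *\<^sub>R y" by transfer (simp add: scaleR_add_right)
  show "(r + s) *\<^sub>R x = r *\<^sub>R x + s *\<^sub>R x" by transfer (simp add: scaleR_add_left)
  show "r *\<^sub>R s *\<^sub>R x = (r * s) *\<^sub>R x" by transfer simp
  show "1 *\<^sub>R x = x" by transfer simp
  show "dist x y = norm (x - y)" by (rule dist_ell2_def)
  show "sgn x = inverse (norm x) *\<^sub>R x" by (rule sgn_ell2_def)
  show "uniformity = (INF e\<in>{0<..}. principal {(x::ell2, y). dist x y < e})"
    by (rule uniformity_ell2_def)
  show "open U \<longleftrightarrow> (\<forall>x\<in>U. \<forall>\<^sub>F (x', y) in uniformity. x' = x \<longrightarrow> y \<in> U)" for U :: "ell2 set"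
    by (rule open_ell2_def)
  show "norm x = 0 \<longleftrightarrow> x = 0"
  proof (transfer, rule iffI)
    fix x assume x: "x \<in> ell 2" and 0: "ell_norm 2 x = 0"
    have "(norm (x n))\<^sup>2 = 0" for n
      by (rule nonneg_infsum_le_0D[of "\<lambda>n. (norm (x n))\<^sup>2" UNIV])
         (use x 0 in \<open>auto simp: ell_2_iff ell_norm_2\<close>)
    then show "x = (\<lambda>_. 0)" by auto
  qed (simp add: ell_norm_2)
  show "norm (x + y) \<le> norm x + norm y" by transfer (rule ell_2_add)
  show "norm (r *\<^sub>R x) = \<bar>r\<bar> * norm x" by transfer (rule ell_norm_2_scaleR)
qed

end

lemma norm_ell2_nth_le: "norm (ell2_nth x n) \<le> norm x"
  by transfer (use ell_2_L2_set_le[of _ "{_}"] in auto)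

definition fwd_diff :: "(int \<Rightarrow> complex) \<Rightarrow> int \<Rightarrow> complex" where
  "fwd_diff a n = a (n + 1) - a n"

text \<open>At a zero difference the factor \<open>0 powr (p - 2)\<close> is 0.\<close>

definition p_laplacian :: "real \<Rightarrow> (int \<Rightarrow> complex) \<Rightarrow> int \<Rightarrow> complex" where
  "p_laplacian p a n =
     (a (n + 1) - a n) * of_real (norm (a (n + 1) - a n) powr (p - 2)) -
     (a n - a (n - 1)) * of_real (norm (a n - a (n - 1)) powr (p - 2))"

text \<open>All norms occurring for square-summable sequences are genuine, i.e. no junk values of
  \<^const>\<open>infsum\<close> or \<^const>\<open>Sup\<close> are involved.\<close>

lemma bdd_above_norm_ell2_nth: "bdd_above (range (\<lambda>n. norm (ell2_nth x n)))"
  by (rule bdd_aboveI2[of _ _ "norm x"]) (rule norm_ell2_nth_le)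

lemma ell_2_subset_ell:
  assumes "2 \<le> q"
  shows "ell 2 \<subseteq> ell q"
proof
  fix x assume x: "x \<in> ell 2"
  let ?C = "ell_norm 2 x"
  have b: "norm (x n) \<le> ?C" for n
    using ell_2_L2_set_le[OF x, of "{n}"] by simp
  have "norm (x n) powr q \<le> ?C powr (q - 2) * (norm (x n))\<^sup>2" for n
  proof -
    have "norm (x n) powr q = norm (x n) powr (q - 2) * norm (x n) powr 2"
      using powr_add[of "norm (x n)" "q - 2" 2] by simp
    also have "\<dots> \<le> ?C powr (q - 2) * (norm (x n))\<^sup>2"
      using b[of n] assms by (auto intro!: mult_mono powr_mono2)
    finally show ?thesis .
  qed
  moreover have "(\<lambda>n. ?C powr (q - 2) * (norm (x n))\<^sup>2) summable_on UNIV"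
    using x by (intro summable_on_cmult_right) (simp add: ell_2_iff)
  ultimately show "x \<in> ell q"
    unfolding ell_def by (auto intro: summable_on_comparison_test)
qed

lemma fwd_diff_ell_2:
  assumes "x \<in> ell 2"
  shows "fwd_diff x \<in> ell 2"
proof -
  have "bij (\<lambda>n::int. n + 1)"
    by (rule bij_betw_byWitness[where f' = "\<lambda>n. n - 1"]) auto
  then have "(\<lambda>n. x (n + 1)) \<in> ell 2"
    using assms summable_on_reindex_bij_betw[of "\<lambda>n. n + 1" UNIV UNIV "\<lambda>n. (norm (x n))\<^sup>2"]
    by (simp add: ell_2_iff)
  from ell_2_diff[OF this assms] show ?thesis
    by (simp add: fwd_diff_def[abs_def])
qed

definition omega0 :: "real \<Rightarrow> real \<Rightarrow> real \<Rightarrow> real" where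
  "omega0 \<alpha> k_minus k_plus = (k_minus + k_plus) * 2 powr ((\<alpha> - 3) / 2) *
     (\<alpha> * Gamma (\<alpha> / 2) / (sqrt pi * (\<alpha> + 1) * Gamma ((\<alpha> + 1) / 2)))"

end

theory Submission
  imports Defs
begin

text \<open>
  The equation conserves the mass \<open>\<Sum>\<^sub>n |a\<^sub>n|\<^sup>2\<close> and the energy \<open>\<Sum>\<^sub>n |\<delta>\<^sub>n|\<^sup>p\<close>, where
  \<open>\<delta>\<^sub>n = a\<^sub>n\<^sub>+\<^sub>1 - a\<^sub>n\<close> and \<open>p = \<alpha> + 1\<close>. For every square-summable \<open>a\<close>, with \<open>M\<close> its supremum norm, one has
  \<open>|\<delta>\<^sub>n/2| \<le> M\<close> and \<open>|\<delta>\<^sub>n/2|\<^sup>2 \<le> (|a\<^sub>n\<^sub>+\<^sub>1|\<^sup>2 + |a\<^sub>n|\<^sup>2)/2\<close>. Hence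
  \<open>\<Sum>\<^sub>n |\<delta>\<^sub>n/2|\<^sup>p \<le> M\<^sup>p\<^sup>-\<^sup>2 \<Sum>\<^sub>n |\<delta>\<^sub>n/2|\<^sup>2 \<le> M\<^sup>p\<^sup>-\<^sup>2 \<Sum>\<^sub>n |a\<^sub>n|\<^sup>2\<close>
  (\<open>infsum_half_fwd_diff_powr_le\<close>). Applied at time \<open>\<tau>\<close>, with both sums replaced by their initial
  values, this is a lower bound for \<open>M\<close>.

  Both conservation laws have a local form. Put \<open>\<phi>\<^sub>n = |\<delta>\<^sub>n|\<^sup>\<alpha>\<^sup>-\<^sup>1 \<delta>\<^sub>n\<close>, so that the equation reads
  \<open>a\<^sub>n' = -\<i> \<omega> (\<phi>\<^sub>n - \<phi>\<^sub>n\<^sub>-\<^sub>1)\<close>. Then each density \<open>u\<^sub>n\<close> satisfies \<open>u\<^sub>n' = J\<^sub>n\<^sub>+\<^sub>1 - J\<^sub>n\<close>, where the current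
  \<open>J\<^sub>n\<close> is a constant multiple of \<open>Im (cnj a\<^sub>n \<phi>\<^sub>n\<^sub>-\<^sub>1)\<close> for the mass and of \<open>Im (cnj \<phi>\<^sub>n \<phi>\<^sub>n\<^sub>-\<^sub>1)\<close> for the
  energy. Summing over \<open>-k \<le> n < k\<close> leaves only two boundary currents. They tend to 0 at each time, but
  uniformity in time is not apparent; since they are bounded on compact time intervals, dominated
  convergence shows that their time integrals vanish in the limit (\<open>infsum_conserved\<close>).
\<close>

section \<open>Derivatives of powers of the modulus\<close>

definition power_map :: "real \<Rightarrow> complex \<Rightarrow> complex" where
  "power_map \<alpha> z = z * of_real (norm z powr (\<alpha> - 1))"

lemma p_laplacian_eq:
  "p_laplacian (\<alpha> + 1) x n = power_map \<alpha> (fwd_diff x n) - power_map \<alpha> (fwd_diff x (n - 1))"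
  by (simp add: p_laplacian_def power_map_def fwd_diff_def)

lemma norm_power_map: "norm (power_map \<alpha> z) = norm z powr \<alpha>"
proof (cases "z = 0")
  case False
  then have "norm z * norm z powr (\<alpha> - 1) = norm z powr \<alpha>"
    using powr_add[of "norm z" 1 "\<alpha> - 1"] by simp
  then show ?thesis by (simp add: power_map_def norm_mult)
qed (simp add: power_map_def)

text \<open>The map \<open>z \<mapsto> |z|\<^sup>\<alpha>\<^sup>-\<^sup>1 z\<close> is a real multiple of \<open>z\<close>: this reality makes the mass current
  telescope.\<close>

lemma Im_cnj_mult_power_map: "Im (cnj z * power_map \<alpha> z) = 0"
  by (simp add: power_map_def algebra_simps)

text \<open>The absolute value is differentiable away from 0 only, but an exponent above 1 makes the
  difference quotient at 0 vanish. This covers sites at which \<open>a\<^sub>n\<^sub>+\<^sub>1 = a\<^sub>n\<close>.\<close>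

lemma has_real_derivative_abs_powr:
  fixes r x :: real
  assumes "r > 1"
  shows "((\<lambda>x. \<bar>x\<bar> powr r) has_real_derivative r * (sgn x * \<bar>x\<bar> powr (r - 1))) (at x)"
proof (cases "x = 0")
  case True
  have "((\<lambda>h::real. sgn h * \<bar>h\<bar> powr (r - 1)) \<longlongrightarrow> 0) (at 0)"
  proof (rule Lim_null_comparison)
    show "\<forall>\<^sub>F h in at 0. norm (sgn h * \<bar>h\<bar> powr (r - 1)) \<le> \<bar>h\<bar> powr (r - 1)"
      by (simp add: abs_mult sgn_if)
    have "((\<lambda>h::real. \<bar>h\<bar> powr (r - 1)) \<longlongrightarrow> \<bar>0\<bar> powr (r - 1)) (at 0)"
      using assms by (intro tendsto_powr2 tendsto_intros) auto
    then show "((\<lambda>h::real. \<bar>h\<bar> powr (r - 1)) \<longlongrightarrow> 0) (at 0)" by simp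
  qed
  moreover have "sgn h * \<bar>h\<bar> powr (r - 1) = \<bar>h\<bar> powr r / h" for h :: real
    by (cases "h = 0") (auto simp: powr_diff sgn_if abs_if)
  ultimately show ?thesis using True by (simp add: DERIV_def)
next
  case False
  (* Near a nonzero point, a power of a square has a positive base and the usual rule applies. *)
  have eq: "\<bar>y\<bar> powr q = (y\<^sup>2) powr (q / 2)" for y q :: real
    using powr_powr[of "\<bar>y\<bar>" 2 "q / 2"] by simp
  have "((\<lambda>y. (y\<^sup>2) powr (r / 2)) has_real_derivative (r / 2) * (x\<^sup>2) powr (r / 2 - 1) * (2 * x)) (at x)"
    using False by (intro DERIV_chain2[OF has_real_derivative_powr]) (auto intro!: derivative_eq_intros)
  moreover have "(r / 2) * (x\<^sup>2) powr (r / 2 - 1) * (2 * x) = r * (sgn x * \<bar>x\<bar> powr (r - 1))"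
  proof -
    have "(x\<^sup>2) powr (r / 2 - 1) = \<bar>x\<bar> powr (r - 2)"
      using eq[of x "r - 2"] by (simp add: diff_divide_distrib)
    moreover have "\<bar>x\<bar> powr (r - 1) = \<bar>x\<bar> * \<bar>x\<bar> powr (r - 2)"
      using False powr_add[of "\<bar>x\<bar>" 1 "r - 2"] by simp
    ultimately show ?thesis by (simp add: sgn_if abs_if)
  qed
  ultimately show ?thesis by (simp only: eq[of _ r])
qed

lemma has_real_derivative_norm_power2:
  fixes z :: "real \<Rightarrow> complex"
  assumes "(z has_vector_derivative z') (at t)"
  shows "((\<lambda>t. (norm (z t))\<^sup>2) has_real_derivative 2 * Re (cnj (z t) * z')) (at t)"
proof -
  have "((\<lambda>t. z t \<bullet> z t) has_real_derivative z t \<bullet> z' + z' \<bullet> z t) (at t)"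
    using bounded_bilinear.has_vector_derivative[OF bounded_bilinear_inner assms assms]
    by (simp add: has_real_derivative_iff_has_vector_derivative)
  then show ?thesis
    by (simp add: power2_norm_eq_inner inner_complex_def algebra_simps)
qed

lemma has_real_derivative_norm_powr:
  fixes z :: "real \<Rightarrow> complex"
  assumes z: "(z has_vector_derivative z') (at t)" and \<alpha>: "\<alpha> > 1"
  shows "((\<lambda>t. norm (z t) powr (\<alpha> + 1)) has_real_derivative
           (\<alpha> + 1) * Re (cnj (power_map \<alpha> (z t)) * z')) (at t)"
proof -
  let ?r = "(\<alpha> + 1) / 2"
  (* The modulus is not differentiable at 0, so the power is taken of its square, whose
     exponent (alpha + 1) / 2 still exceeds 1. *)
  have powr_sq: "\<bar>(norm w)\<^sup>2\<bar> powr q = norm w powr (2 * q)" for w :: complex and q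
    using powr_powr[of "norm w" 2 q] by simp
  have powr_r: "\<bar>(norm w)\<^sup>2\<bar> powr ?r = norm w powr (\<alpha> + 1)"
    and powr_r1: "\<bar>(norm w)\<^sup>2\<bar> powr (?r - 1) = norm w powr (\<alpha> - 1)" for w :: complex
    unfolding powr_sq by (intro arg_cong[where f = "(powr) (norm w)"]; simp add: field_simps)+
  have "((\<lambda>t. \<bar>(norm (z t))\<^sup>2\<bar> powr ?r) has_real_derivative
      ?r * (sgn ((norm (z t))\<^sup>2) * \<bar>(norm (z t))\<^sup>2\<bar> powr (?r - 1)) * (2 * Re (cnj (z t) * z'))) (at t)"
    using \<alpha> by (intro DERIV_chain2[OF has_real_derivative_abs_powr] has_real_derivative_norm_power2 z) auto
  moreover have "?r * (sgn ((norm (z t))\<^sup>2) * norm (z t) powr (\<alpha> - 1)) * (2 * Re (cnj (z t) * z'))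
      = (\<alpha> + 1) * Re (cnj (power_map \<alpha> (z t)) * z')"
    by (cases "z t = 0") (simp_all add: power_map_def sgn_if algebra_simps)
  ultimately show ?thesis by (simp only: powr_r powr_r1)
qed

section \<open>Conserved sums from local conservation laws\<close>

lemma tendsto_sum_symmetric_intervals:
  fixes f :: "int \<Rightarrow> real"
  assumes "f summable_on UNIV"
  shows "(\<lambda>k. \<Sum>n\<in>{- int k..<int k}. f n) \<longlonglongrightarrow> infsum f UNIV"
proof -
  have "filterlim (\<lambda>k. {- int k..<int k}) (finite_subsets_at_top UNIV) sequentially"
    unfolding filterlim_finite_subsets_at_top
  proof safe
    fix X :: "int set" assume "finite X"
    then obtain B where B: "\<forall>n\<in>X. \<bar>n\<bar> < B"
      unfolding finite_int_iff_bounded by blast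
    show "\<forall>\<^sub>F k in sequentially. finite {- int k..<int k} \<and> X \<subseteq> {- int k..<int k} \<and> {- int k..<int k} \<subseteq> UNIV"
      using eventually_ge_at_top[of "nat B"] by eventually_elim (use B in force)
  qed
  then show ?thesis
    using has_sum_infsum[OF assms] unfolding has_sum_def by (rule filterlim_compose[rotated])
qed

lemma sum_telescope_int:
  fixes f :: "int \<Rightarrow> real"
  shows "(\<Sum>n\<in>{- int k..<int k}. f (n + 1) - f n) = f (int k) - f (- int k)"
proof (induction k)
  case (Suc k)
  have "{- int (Suc k)..<int (Suc k)} = insert (- int k - 1) (insert (int k) {- int k..<int k})"
    by auto
  moreover have "f (- int (Suc k)) = f (- int k - 1)" "f (int (Suc k)) = f (int k + 1)"
    by (intro arg_cong[where f = f]; simp)+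
  ultimately show ?case using Suc by (simp del: of_nat_Suc)
qed simp

lemma filterlim_cofinite_inj:
  fixes f :: "'a \<Rightarrow> 'b"
  assumes "inj f"
  shows "filterlim f cofinite cofinite"
  unfolding filterlim_iff eventually_cofinite
proof safe
  fix P :: "'b \<Rightarrow> bool" assume "finite {y. \<not> P y}"
  from finite_vimageI[OF this assms] show "finite {x. \<not> P (f x)}" by (simp add: vimage_def)
qed

text \<open>Finite partial sums change by the time integral of the boundary currents. That difference of
  currents is integrable as the derivative of the partial sum, and its integral tends to 0 by dominated
  convergence, with a constant as dominating function.\<close>

lemma infsum_conserved_forward:
  fixes u J :: "int \<Rightarrow> real \<Rightarrow> real"
  assumes "s \<le> t"
    and deriv: "\<And>n \<tau>. (u n has_real_derivative J (n + 1) \<tau> - J n \<tau>) (at \<tau>)"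
    and bound: "\<And>n \<tau>. \<tau> \<in> {s..t} \<Longrightarrow> \<bar>J n \<tau>\<bar> \<le> C"
    and decay: "\<And>\<tau>. ((\<lambda>n. J n \<tau>) \<longlongrightarrow> 0) cofinite"
    and summable: "\<And>\<tau>. (\<lambda>n. u n \<tau>) summable_on UNIV"
  shows "(\<Sum>\<^sub>\<infinity>n. u n t) = (\<Sum>\<^sub>\<infinity>n. u n s)"
proof -
  define S where "S k \<tau> = (\<Sum>n\<in>{- int k..<int k}. u n \<tau>)" for k \<tau>
  define F where "F k \<tau> = J (int k) \<tau> - J (- int k) \<tau>" for k \<tau>
  have int: "(F k has_integral S k t - S k s) {s..t}" for k
  proof (rule fundamental_theorem_of_calculus[OF \<open>s \<le> t\<close>])
    fix \<tau>
    have "(S k has_real_derivative (\<Sum>n\<in>{- int k..<int k}. J (n + 1) \<tau> - J n \<tau>)) (at \<tau>)"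
      unfolding S_def by (intro DERIV_sum deriv)
    then have "(S k has_real_derivative F k \<tau>) (at \<tau>)"
      by (simp add: sum_telescope_int[of "\<lambda>n. J n \<tau>"] F_def)
    then show "(S k has_vector_derivative F k \<tau>) (at \<tau> within {s..t})"
      by (simp add: has_real_derivative_iff_has_vector_derivative has_vector_derivative_at_within)
  qed
  have "(\<lambda>k. integral {s..t} (F k)) \<longlonglongrightarrow> integral {s..t} (\<lambda>_. 0)"
  proof (rule dominated_convergence)
    show "F k integrable_on {s..t}" for k using int by blast
    show "(\<lambda>_. 2 * C) integrable_on {s..t}" by (rule integrable_const_ivl)
    show "norm (F k \<tau>) \<le> 2 * C" if "\<tau> \<in> {s..t}" for k \<tau>
      using bound[OF that, of "int k"] bound[OF that, of "- int k"] unfolding F_def by simp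
    show "(\<lambda>k. F k \<tau>) \<longlonglongrightarrow> 0" for \<tau>
    proof -
      have "filterlim int cofinite sequentially" "filterlim (\<lambda>k. - int k) cofinite sequentially"
        unfolding cofinite_eq_sequentially[symmetric]
        by (auto simp: inj_def intro!: filterlim_cofinite_inj)
      from decay[THEN filterlim_compose, OF this(1)] decay[THEN filterlim_compose, OF this(2)]
      have "(\<lambda>k. J (int k) \<tau> - J (- int k) \<tau>) \<longlonglongrightarrow> 0 - 0" by (intro tendsto_diff)
      then show ?thesis by (simp add: F_def)
    qed
  qed
  moreover have "integral {s..t} (F k) = S k t - S k s" for k
    by (rule integral_unique[OF int])
  ultimately have "(\<lambda>k. S k t - S k s) \<longlonglongrightarrow> 0" by simp
  moreover have "(\<lambda>k. S k t - S k s) \<longlonglongrightarrow> (\<Sum>\<^sub>\<infinity>n. u n t) - (\<Sum>\<^sub>\<infinity>n. u n s)"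
    unfolding S_def by (intro tendsto_diff tendsto_sum_symmetric_intervals summable)
  ultimately show ?thesis using LIMSEQ_unique by fastforce
qed

lemma infsum_conserved:
  fixes u J :: "int \<Rightarrow> real \<Rightarrow> real"
  assumes "\<And>n \<tau>. (u n has_real_derivative J (n + 1) \<tau> - J n \<tau>) (at \<tau>)"
    and bound: "\<And>s t. \<exists>C. \<forall>\<tau>\<in>{s..t}. \<forall>n. \<bar>J n \<tau>\<bar> \<le> C"
    and "\<And>\<tau>. ((\<lambda>n. J n \<tau>) \<longlongrightarrow> 0) cofinite"
    and "\<And>\<tau>. (\<lambda>n. u n \<tau>) summable_on UNIV"
  shows "(\<Sum>\<^sub>\<infinity>n. u n t) = (\<Sum>\<^sub>\<infinity>n. u n s)"
proof -
  have "(\<Sum>\<^sub>\<infinity>n. u n t') = (\<Sum>\<^sub>\<infinity>n. u n s')" if "s' \<le> t'" for s' t'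
  proof -
    obtain C where "\<forall>\<tau>\<in>{s'..t'}. \<forall>n. \<bar>J n \<tau>\<bar> \<le> C" using bound by blast
    then show ?thesis using assms by (intro infsum_conserved_forward[OF that, of u J C]) auto
  qed
  from this[of s t] this[of t s] show ?thesis by linarith
qed

section \<open>Square-summable sequences\<close>

text \<open>Only finitely many terms can exceed a given size, as each contributes at least its square to a
  finite sum.\<close>

lemma tendsto_cofinite_ell2_nth: "(ell2_nth x \<longlongrightarrow> 0) cofinite"
proof (rule tendstoI)
  fix e :: real assume e: "e > 0"
  have sm: "(\<lambda>n. (norm (ell2_nth x n))\<^sup>2) summable_on UNIV"
    using ell2_nth[of x] by (simp add: ell_2_iff)
  let ?S = "\<Sum>\<^sub>\<infinity>n. (norm (ell2_nth x n))\<^sup>2"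
  have "card F \<le> nat \<lfloor>?S / e\<^sup>2\<rfloor>" if F: "F \<subseteq> {n. \<not> dist (ell2_nth x n) 0 < e}" "finite F" for F
  proof -
    have "real (card F) * e\<^sup>2 = (\<Sum>n\<in>F. e\<^sup>2)" by simp
    also have "\<dots> \<le> (\<Sum>n\<in>F. (norm (ell2_nth x n))\<^sup>2)"
      using F e by (intro sum_mono power_mono) auto
    also have "\<dots> \<le> ?S"
      using F sm by (intro finite_sum_le_infsum) auto
    finally show ?thesis using e by (simp add: pos_le_divide_eq le_nat_floor)
  qed
  then have "finite {n. \<not> dist (ell2_nth x n) 0 < e}"
    using finite_if_finite_subsets_card_bdd by blast
  then show "\<forall>\<^sub>F n in cofinite. dist (ell2_nth x n) 0 < e"
    by (simp add: eventually_cofinite)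
qed

lemma bij_add_1_int: "bij (\<lambda>n::int. n + 1)"
  by (rule bij_betw_byWitness[where f' = "\<lambda>n. n - 1"]) auto

lemmas infsum_shift_int = infsum_reindex_bij_betw[OF bij_add_1_int]
lemmas summable_on_shift_int = summable_on_reindex_bij_betw[OF bij_add_1_int]

lemma norm_fwd_diff_le: "norm (fwd_diff (ell2_nth x) n) \<le> 2 * norm x"
  using norm_triangle_ineq4[of "ell2_nth x (n + 1)" "ell2_nth x n"]
    norm_ell2_nth_le[of x n] norm_ell2_nth_le[of x "n + 1"]
  by (simp add: fwd_diff_def)

lemma summable_fwd_diff_powr:
  assumes "p \<ge> 2"
  shows "(\<lambda>n. norm (fwd_diff (ell2_nth x) n) powr p) summable_on UNIV"
  using ell_2_subset_ell[OF assms] fwd_diff_ell_2[OF ell2_nth[of x]] by (auto simp: ell_def)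

lemma tendsto_cofinite_fwd_diff: "(fwd_diff (ell2_nth x) \<longlongrightarrow> 0) cofinite"
  using tendsto_cofinite_ell2_nth[of "Ell2 (fwd_diff (ell2_nth x))"]
  by (simp add: Ell2_inverse fwd_diff_ell_2[OF ell2_nth])

lemma norm_power_map_fwd_diff_le:
  assumes "\<alpha> > 0"
  shows "norm (power_map \<alpha> (fwd_diff (ell2_nth x) n)) \<le> (2 * norm x) powr \<alpha>"
  using assms by (simp add: norm_power_map powr_mono2 norm_fwd_diff_le)

lemma tendsto_cofinite_power_map_fwd_diff:
  assumes "\<alpha> > 0"
  shows "((\<lambda>n. power_map \<alpha> (fwd_diff (ell2_nth x) n)) \<longlongrightarrow> 0) cofinite"
proof (rule tendsto_norm_zero_cancel)
  have "((\<lambda>n. norm (fwd_diff (ell2_nth x) n) powr \<alpha>) \<longlongrightarrow> 0 powr \<alpha>) cofinite"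
    using assms by (intro tendsto_powr2 tendsto_norm_zero tendsto_cofinite_fwd_diff) auto
  then show "((\<lambda>n. norm (power_map \<alpha> (fwd_diff (ell2_nth x) n))) \<longlongrightarrow> 0) cofinite"
    using assms by (simp add: norm_power_map)
qed

lemma tendsto_cofinite_Im_cnj_mult:
  fixes f g :: "int \<Rightarrow> complex"
  assumes "(f \<longlongrightarrow> 0) cofinite" "\<And>n. norm (g n) \<le> B"
  shows "((\<lambda>n. c * Im (cnj (g n) * f n)) \<longlongrightarrow> 0) cofinite"
proof (rule Lim_null_comparison)
  show "\<forall>\<^sub>F n in cofinite. norm (c * Im (cnj (g n) * f n)) \<le> \<bar>c\<bar> * (B * norm (f n))"
  proof (intro always_eventually allI)
    fix n
    have "\<bar>Im (cnj (g n) * f n)\<bar> \<le> norm (g n) * norm (f n)"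
      using abs_Im_le_cmod[of "cnj (g n) * f n"] by (simp add: norm_mult)
    also have "\<dots> \<le> B * norm (f n)" by (intro mult_right_mono assms) auto
    finally show "norm (c * Im (cnj (g n) * f n)) \<le> \<bar>c\<bar> * (B * norm (f n))"
      by (simp add: abs_mult mult_left_mono)
  qed
  have "((\<lambda>n. \<bar>c\<bar> * (B * norm (f n))) \<longlongrightarrow> \<bar>c\<bar> * (B * 0)) cofinite"
    using assms(1) by (intro tendsto_intros tendsto_norm_zero)
  then show "((\<lambda>n. \<bar>c\<bar> * (B * norm (f n))) \<longlongrightarrow> 0) cofinite" by simp
qed

lemma Im_cnj_mult_bounded:
  fixes f g :: "int \<Rightarrow> real \<Rightarrow> complex"
  assumes "\<exists>R. \<forall>\<tau>\<in>T. \<forall>n. norm (f n \<tau>) \<le> R" "\<exists>R. \<forall>\<tau>\<in>T. \<forall>n. norm (g n \<tau>) \<le> R"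
  shows "\<exists>C. \<forall>\<tau>\<in>T. \<forall>n. \<bar>c * Im (cnj (f n \<tau>) * g (n - 1) \<tau>)\<bar> \<le> C"
proof -
  obtain Q R where Q: "\<forall>\<tau>\<in>T. \<forall>n. norm (f n \<tau>) \<le> Q" and R: "\<forall>\<tau>\<in>T. \<forall>n. norm (g n \<tau>) \<le> R"
    using assms by blast
  have "\<bar>c * Im (cnj (f n \<tau>) * g (n - 1) \<tau>)\<bar> \<le> \<bar>c\<bar> * (Q * R)" if "\<tau> \<in> T" for n \<tau>
  proof -
    have "\<bar>Im (cnj (f n \<tau>) * g (n - 1) \<tau>)\<bar> \<le> norm (f n \<tau>) * norm (g (n - 1) \<tau>)"
      using abs_Im_le_cmod[of "cnj (f n \<tau>) * g (n - 1) \<tau>"] by (simp add: norm_mult)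
    also have "\<dots> \<le> Q * R"
      using Q R that by (intro mult_mono) (auto intro: order_trans[OF norm_ge_zero])
    finally show ?thesis by (simp add: abs_mult mult_left_mono)
  qed
  then show ?thesis by blast
qed

section \<open>Mass and energy of the discrete \<open>p\<close>-Schroedinger equation\<close>

locale p_schroedinger =
  fixes \<alpha> \<omega> :: real and a :: "real \<Rightarrow> ell2"
  assumes \<alpha>: "\<alpha> > 1"
    and continuous: "continuous_on UNIV a"
    and nth_deriv: "((\<lambda>t. ell2_nth (a t) n) has_vector_derivative
          - \<i> * of_real \<omega> * p_laplacian (\<alpha> + 1) (ell2_nth (a \<tau>)) n) (at \<tau>)"
begin

text \<open>The \<open>\<phi>\<^sub>n\<close> of the introductory text; bond \<open>n\<close> joins the sites \<open>n\<close> and \<open>n + 1\<close>.\<close>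

definition bond_force :: "int \<Rightarrow> real \<Rightarrow> complex" where
  "bond_force n \<tau> = power_map \<alpha> (fwd_diff (ell2_nth (a \<tau>)) n)"

lemma nth_deriv_bond_force: "((\<lambda>t. ell2_nth (a t) n) has_vector_derivative
    - \<i> * of_real \<omega> * (bond_force n \<tau> - bond_force (n - 1) \<tau>)) (at \<tau>)"
  using nth_deriv by (simp add: p_laplacian_eq bond_force_def)

text \<open>The two ends of a bond differ by \<open>\<delta>\<^sub>n\<close>, and \<open>cnj \<delta>\<^sub>n \<phi>\<^sub>n\<close> is real. So the mass that leaves one
  end of the bond arrives at the other.\<close>

lemma Im_cnj_nth_bond_force:
  "Im (cnj (ell2_nth (a \<tau>) (n + 1)) * bond_force n \<tau>) = Im (cnj (ell2_nth (a \<tau>) n) * bond_force n \<tau>)"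
  using Im_cnj_mult_power_map[of "fwd_diff (ell2_nth (a \<tau>)) n" \<alpha>]
  by (simp add: bond_force_def fwd_diff_def algebra_simps)

lemma norm_bounded_on_interval: "\<exists>R. \<forall>\<tau>\<in>{s..t}. norm (a \<tau>) \<le> R"
proof -
  have "compact (a ` {s..t})"
    by (intro compact_continuous_image continuous_on_subset[OF continuous]) auto
  then have "bounded (a ` {s..t})" by (rule compact_imp_bounded)
  then show ?thesis
    unfolding bounded_iff by blast
qed

lemma bond_force_bounded_on_interval: "\<exists>R. \<forall>\<tau>\<in>{s..t}. \<forall>n. norm (bond_force n \<tau>) \<le> R"
proof -
  obtain R where R: "\<And>\<tau>. \<tau> \<in> {s..t} \<Longrightarrow> norm (a \<tau>) \<le> R"
    using norm_bounded_on_interval by blast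
  have "norm (bond_force n \<tau>) \<le> (2 * R) powr \<alpha>" if "\<tau> \<in> {s..t}" for n \<tau>
  proof -
    have "norm (bond_force n \<tau>) \<le> (2 * norm (a \<tau>)) powr \<alpha>"
      unfolding bond_force_def using \<alpha> by (intro norm_power_map_fwd_diff_le) simp
    also have "\<dots> \<le> (2 * R) powr \<alpha>"
      using \<alpha> R[OF that] by (intro powr_mono2) auto
    finally show ?thesis .
  qed
  then show ?thesis by blast
qed

lemma tendsto_bond_force: "((\<lambda>n. bond_force n \<tau>) \<longlongrightarrow> 0) cofinite"
  unfolding bond_force_def using \<alpha> by (intro tendsto_cofinite_power_map_fwd_diff) simp

lemma tendsto_bond_force_shift: "((\<lambda>n. bond_force (n - 1) \<tau>) \<longlongrightarrow> 0) cofinite"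
proof (rule filterlim_compose[OF tendsto_bond_force])
  show "filterlim (\<lambda>n::int. n - 1) cofinite cofinite"
    by (rule filterlim_cofinite_inj) (simp add: inj_def)
qed

lemma mass_conserved: "norm (a t) = norm (a s)"
proof -
  define J where "J n \<tau> = 2 * \<omega> * Im (cnj (ell2_nth (a \<tau>) n) * bond_force (n - 1) \<tau>)" for n \<tau>
  have "(\<Sum>\<^sub>\<infinity>n. (norm (ell2_nth (a t) n))\<^sup>2) = (\<Sum>\<^sub>\<infinity>n. (norm (ell2_nth (a s) n))\<^sup>2)"
  proof (rule infsum_conserved[of "\<lambda>n \<tau>. (norm (ell2_nth (a \<tau>) n))\<^sup>2" J])
    fix n \<tau>
    have "2 * Re (cnj (ell2_nth (a \<tau>) n) * (- \<i> * of_real \<omega> * (bond_force n \<tau> - bond_force (n - 1) \<tau>)))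
       = J (n + 1) \<tau> - J n \<tau>"
    proof -
      have "J (n + 1) \<tau> = 2 * \<omega> * Im (cnj (ell2_nth (a \<tau>) n) * bond_force n \<tau>)"
        using Im_cnj_nth_bond_force[of \<tau> n] by (simp add: J_def del: times_complex.sel)
      then show ?thesis by (simp add: J_def algebra_simps)
    qed
    with has_real_derivative_norm_power2[OF nth_deriv_bond_force]
    show "((\<lambda>\<tau>. (norm (ell2_nth (a \<tau>) n))\<^sup>2) has_real_derivative J (n + 1) \<tau> - J n \<tau>) (at \<tau>)"
      by metis
  next
    fix s t
    show "\<exists>C. \<forall>\<tau>\<in>{s..t}. \<forall>n. \<bar>J n \<tau>\<bar> \<le> C"
      unfolding J_def
      using norm_bounded_on_interval norm_ell2_nth_le
      by (intro Im_cnj_mult_bounded bond_force_bounded_on_interval) (meson order_trans)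
  next
    show "((\<lambda>n. J n \<tau>) \<longlongrightarrow> 0) cofinite" for \<tau>
      unfolding J_def
      by (rule tendsto_cofinite_Im_cnj_mult[where B = "norm (a \<tau>)"])
         (rule tendsto_bond_force_shift norm_ell2_nth_le)+
  next
    show "(\<lambda>n. (norm (ell2_nth (a \<tau>) n))\<^sup>2) summable_on UNIV" for \<tau>
      using ell2_nth[of "a \<tau>"] by (simp add: ell_2_iff)
  qed
  then show ?thesis by (simp add: norm_ell2.rep_eq ell_norm_2)
qed

text \<open>Here \<open>\<delta>\<^sub>n' = -\<i> \<omega> (\<phi>\<^sub>n\<^sub>+\<^sub>1 - 2 \<phi>\<^sub>n + \<phi>\<^sub>n\<^sub>-\<^sub>1)\<close>. In \<open>Re (cnj \<phi>\<^sub>n \<delta>\<^sub>n')\<close> the middle term drops out because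
  \<open>cnj \<phi>\<^sub>n \<phi>\<^sub>n\<close> is real, and the outer two form a telescoping difference because
  \<open>Im (cnj z w) = - Im (cnj w z)\<close>.\<close>

lemma energy_conserved:
  "(\<Sum>\<^sub>\<infinity>n. norm (fwd_diff (ell2_nth (a t)) n) powr (\<alpha> + 1)) =
   (\<Sum>\<^sub>\<infinity>n. norm (fwd_diff (ell2_nth (a s)) n) powr (\<alpha> + 1))"
proof -
  define J where "J n \<tau> = - (\<alpha> + 1) * \<omega> * Im (cnj (bond_force n \<tau>) * bond_force (n - 1) \<tau>)" for n \<tau>
  show ?thesis
  proof (rule infsum_conserved[of "\<lambda>n \<tau>. norm (fwd_diff (ell2_nth (a \<tau>)) n) powr (\<alpha> + 1)" J])
    fix n \<tau>
    have "((\<lambda>t. fwd_diff (ell2_nth (a t)) n) has_vector_derivative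
        - \<i> * of_real \<omega> * (bond_force (n + 1) \<tau> - 2 * bond_force n \<tau> + bond_force (n - 1) \<tau>)) (at \<tau>)"
      using has_vector_derivative_diff[OF nth_deriv_bond_force[of "n + 1" \<tau>] nth_deriv_bond_force[of n \<tau>]]
      by (simp add: fwd_diff_def algebra_simps)
    from has_real_derivative_norm_powr[OF this \<alpha>]
    show "((\<lambda>\<tau>. norm (fwd_diff (ell2_nth (a \<tau>)) n) powr (\<alpha> + 1)) has_real_derivative
        J (n + 1) \<tau> - J n \<tau>) (at \<tau>)"
      by (simp add: J_def algebra_simps flip: bond_force_def)
  next
    show "\<exists>C. \<forall>\<tau>\<in>{s..t}. \<forall>n. \<bar>J n \<tau>\<bar> \<le> C" for s t
      unfolding J_def by (intro Im_cnj_mult_bounded bond_force_bounded_on_interval)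
  next
    show "((\<lambda>n. J n \<tau>) \<longlongrightarrow> 0) cofinite" for \<tau>
    proof -
      obtain R where "\<forall>n. norm (bond_force n \<tau>) \<le> R"
        using bond_force_bounded_on_interval[of \<tau> \<tau>] by auto
      then show ?thesis
        unfolding J_def by (intro tendsto_cofinite_Im_cnj_mult tendsto_bond_force_shift) auto
    qed
  next
    show "(\<lambda>n. norm (fwd_diff (ell2_nth (a \<tau>)) n) powr (\<alpha> + 1)) summable_on UNIV" for \<tau>
      using \<alpha> by (intro summable_fwd_diff_powr) simp
  qed
qed

end

section \<open>The lower bound on the supremum norm\<close>

text \<open>The factor 1/2 turns the difference into an average, so that neither the supremum norm
  nor the square sum picks up a constant.\<close>

lemma infsum_half_fwd_diff_powr_le:
  assumes p: "p \<ge> 2"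
  shows "(\<Sum>\<^sub>\<infinity>n. norm (1 / 2 * fwd_diff (ell2_nth x) n) powr p)
      \<le> ell_infnorm (ell2_nth x) powr (p - 2) * (norm x)\<^sup>2"
proof -
  define M where "M = ell_infnorm (ell2_nth x)"
  define u where "u n = (norm (ell2_nth x n))\<^sup>2" for n
  have u: "u summable_on UNIV" using ell2_nth[of x] by (simp add: ell_2_iff u_def[abs_def])
  then have u1: "(\<lambda>n. u (n + 1)) summable_on UNIV" by (simp add: summable_on_shift_int)
  have M: "norm (ell2_nth x n) \<le> M" for n
    unfolding M_def ell_infnorm_def by (intro cSUP_upper bdd_above_norm_ell2_nth) auto
  have le: "norm (1 / 2 * fwd_diff (ell2_nth x) n) powr p \<le> M powr (p - 2) * (1 / 2 * (u (n + 1) + u n))" for n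
  proof -
    let ?d = "norm (1 / 2 * fwd_diff (ell2_nth x) n)"
    have half: "?d \<le> (norm (ell2_nth x (n + 1)) + norm (ell2_nth x n)) / 2"
      using norm_triangle_ineq4[of "ell2_nth x (n + 1)" "ell2_nth x n"]
      by (simp add: fwd_diff_def norm_mult norm_divide)
    have "?d\<^sup>2 \<le> ((norm (ell2_nth x (n + 1)) + norm (ell2_nth x n)) / 2)\<^sup>2"
      by (intro power_mono half) simp
    also have "\<dots> \<le> 1 / 2 * (u (n + 1) + u n)"
      using sum_squares_bound[of "norm (ell2_nth x (n + 1))" "norm (ell2_nth x n)"]
      by (simp add: u_def power2_eq_square field_simps)
    finally have sq: "?d\<^sup>2 \<le> 1 / 2 * (u (n + 1) + u n)" .
    have "?d powr p = ?d powr (p - 2) * ?d\<^sup>2"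
      using powr_add[of ?d "p - 2" 2] by simp
    also have "\<dots> \<le> M powr (p - 2) * (1 / 2 * (u (n + 1) + u n))"
      using half M[of n] M[of "n + 1"] p sq by (intro mult_mono powr_mono2) auto
    finally show ?thesis .
  qed
  have "(\<lambda>n. 1 / 2 * fwd_diff (ell2_nth x) n) \<in> ell p"
    using ell_2_subset_ell[OF p] ell_2_scaleR[OF fwd_diff_ell_2[OF ell2_nth[of x]], of "1 / 2"]
    by (auto simp: scaleR_conv_of_real)
  then have "(\<Sum>\<^sub>\<infinity>n. norm (1 / 2 * fwd_diff (ell2_nth x) n) powr p)
      \<le> (\<Sum>\<^sub>\<infinity>n. M powr (p - 2) * (1 / 2 * (u (n + 1) + u n)))"
    by (intro infsum_mono le summable_on_cmult_right summable_on_add u u1) (simp add: ell_def)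
  also have "\<dots> = M powr (p - 2) * (1 / 2 * ((\<Sum>\<^sub>\<infinity>n. u (n + 1)) + (\<Sum>\<^sub>\<infinity>n. u n)))"
    by (simp only: infsum_cmult_right' infsum_add[OF u1 u])
  also have "\<dots> = M powr (p - 2) * (norm x)\<^sup>2"
    by (simp add: infsum_shift_int[of u] norm_ell2.rep_eq ell_norm_2 infsum_nonneg flip: u_def) (simp add: u_def infsum_nonneg)
  finally show ?thesis by (simp add: M_def)
qed

lemma bounded_linear_ell2_nth: "bounded_linear (\<lambda>x. ell2_nth x n)"
  by (rule bounded_linear_intro[where K = 1])
     (auto simp: plus_ell2.rep_eq scaleR_ell2.rep_eq norm_ell2_nth_le)

theorem lemma2p9:
  fixes \<alpha> k_minus k_plus :: real
    and a0 :: ell2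
    and a :: "real \<Rightarrow> ell2"
  assumes "\<alpha> > 1"
    and "(k_minus, k_plus) \<noteq> (0, 0)"
    and "a0 \<noteq> 0"
    and "a C1_differentiable_on UNIV"
    and "\<And>\<tau> n. \<i> * vector_derivative (\<lambda>t. ell2_nth (a t) n) (at \<tau>) =
           of_real (omega0 \<alpha> k_minus k_plus) * p_laplacian (\<alpha> + 1) (ell2_nth (a \<tau>)) n"
    and "a 0 = a0"
  shows "\<forall>\<tau>. ell_infnorm (ell2_nth (a \<tau>)) \<ge>
           (ell_norm (\<alpha> + 1) (\<lambda>n. 1 / 2 * fwd_diff (ell2_nth a0) n) powr (\<alpha> + 1)
             / (ell_norm 2 (ell2_nth a0))\<^sup>2) powr (1 / (\<alpha> - 1))"
proof
  fix \<tau>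
  have diff: "a differentiable at t" for t
    using assms(4) by (simp add: C1_differentiable_on_eq)
  interpret p_schroedinger \<alpha> "omega0 \<alpha> k_minus k_plus" a
  proof
    show "continuous_on UNIV a"
      using diff differentiable_imp_continuous_within continuous_at_imp_continuous_on by blast
    fix n t
    let ?z = "\<lambda>t. ell2_nth (a t) n"
    have "(?z has_vector_derivative ell2_nth (vector_derivative a (at t)) n) (at t)"
      by (rule bounded_linear.has_vector_derivative[OF bounded_linear_ell2_nth])
         (use diff vector_derivative_works in blast)
    then have "(?z has_vector_derivative vector_derivative ?z (at t)) (at t)"
      by (simp add: vector_derivative_at)
    moreover have "vector_derivative ?z (at t) = - \<i> * (\<i> * vector_derivative ?z (at t))"
      by simp
    ultimately show "(?z has_vector_derivative - \<i> * of_real (omega0 \<alpha> k_minus k_plus) *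
        p_laplacian (\<alpha> + 1) (ell2_nth (a t)) n) (at t)"
      unfolding assms(5) by (simp add: mult.assoc)
  qed fact
  let ?M = "ell_infnorm (ell2_nth (a \<tau>))"
  let ?E = "\<lambda>x. \<Sum>\<^sub>\<infinity>n. norm (1 / 2 * fwd_diff (ell2_nth x) n) powr (\<alpha> + 1)"
  have M: "?M \<ge> 0"
    unfolding ell_infnorm_def by (rule cSUP_upper2[OF bdd_above_norm_ell2_nth]) auto
  have E: "?E x = (1 / 2) powr (\<alpha> + 1) * (\<Sum>\<^sub>\<infinity>n. norm (fwd_diff (ell2_nth x) n) powr (\<alpha> + 1))" for x
    by (simp add: norm_mult norm_divide powr_mult powr_divide infsum_cmult_right' flip: infsum_cmult_right')
  have "ell_norm (\<alpha> + 1) (\<lambda>n. 1 / 2 * fwd_diff (ell2_nth a0) n) powr (\<alpha> + 1) = ?E a0"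
    using \<alpha> by (simp add: ell_norm_def powr_powr infsum_nonneg)
  also have "\<dots> = ?E (a \<tau>)"
    using energy_conserved[of \<tau> 0] assms(6) by (simp only: E)
  also have "\<dots> \<le> ?M powr (\<alpha> + 1 - 2) * (norm (a \<tau>))\<^sup>2"
    using \<alpha> by (intro infsum_half_fwd_diff_powr_le) simp
  also have "norm (a \<tau>) = norm a0"
    using mass_conserved[of \<tau> 0] assms(6) by simp
  finally have "ell_norm (\<alpha> + 1) (\<lambda>n. 1 / 2 * fwd_diff (ell2_nth a0) n) powr (\<alpha> + 1)
      / (norm a0)\<^sup>2 \<le> ?M powr (\<alpha> - 1)"
    using assms(3) by (simp add: pos_divide_le_eq)
  then have "(ell_norm (\<alpha> + 1) (\<lambda>n. 1 / 2 * fwd_diff (ell2_nth a0) n) powr (\<alpha> + 1)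
      / (norm a0)\<^sup>2) powr (1 / (\<alpha> - 1)) \<le> (?M powr (\<alpha> - 1)) powr (1 / (\<alpha> - 1))"
    using \<alpha> by (intro powr_mono2) auto
  also have "\<dots> = ?M" using \<alpha> M by (simp add: powr_powr)
  finally show "?M \<ge> (ell_norm (\<alpha> + 1) (\<lambda>n. 1 / 2 * fwd_diff (ell2_nth a0) n) powr (\<alpha> + 1)
             / (ell_norm 2 (ell2_nth a0))\<^sup>2) powr (1 / (\<alpha> - 1))"
    by (simp add: norm_ell2.rep_eq)
qed

end
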